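(* Let $\beta\in\mathbb{N}$ and $\lambda\ge2$ an integer, and let $H_n(\lambda,\beta,\gamma)$ denote the coefficient of $\frac{x^n}{n!}$ in $\frac{e^{\gamma x}}{(2-e^{\beta x})^{\lambda}}$. Then for every $n\in\mathbb{N}_0$, $$H_n(\lambda,\beta,\beta)=\frac12H_n(\lambda-1,\beta,\beta)+\frac{1}{2\beta(\lambda-1)}\sum_{i=0}^{n}\binom{n}{i}H_{i+1}(\lambda-1,\beta,0)\,\beta^{n-i}.$$ *)

theory Defs
  imports Complex_Main "HOL-Computational_Algebra.Formal_Power_Series"
begin

text \<open>
  The coefficient of \<open>x ^ n / n!\<close> in the formal power series
  \<open>exp (\<gamma> x) / (2 - exp (\<beta> x)) ^ l\<close>. The denominator has constant coefficient 1,
  so the division is by a unit.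
\<close>

definition H :: "nat \<Rightarrow> nat \<Rightarrow> real \<Rightarrow> real \<Rightarrow> real" where
  "H n l \<beta> \<gamma> = fact n * fps_nth (fps_exp \<gamma> / (2 - fps_exp \<beta>) ^ l) n"

end

(*
  Write E = exp (\<beta> x) and J = 1 / (2 - E), so that J' = \<beta> E J^2 and (J^m)' = m \<beta> E J^(m+1).
  The binomial sum is the coefficient of E (J^m)' = m \<beta> E^2 J^(m+1), and the claim becomes
  2 E J^(m+1) = E J^m + E^2 J^(m+1), i.e. (2 - E) J = 1.
*)
theory Submission
  imports Defs
begin

text \<open>The denominator has constant coefficient 1, so dividing by it is multiplying by its
  inverse; powers of that inverse are easy to differentiate.\<close>

lemma H_conv_inverse:
  "H n l \<beta> \<gamma> = fact n * fps_nth (fps_exp \<gamma> * inverse (2 - fps_exp \<beta>) ^ l) n"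
proof -
  have "fps_nth ((2 - fps_exp \<beta> :: real fps) ^ l) 0 \<noteq> 0"
    by (simp add: fps_power_zeroth)
  thus ?thesis
    by (simp add: H_def fps_divide_unit fps_inverse_power)
qed

lemma inverse_two_minus_exp:
  "(2 - fps_exp \<beta>) * inverse (2 - fps_exp \<beta>) = (1 :: real fps)"
  by (simp add: inverse_mult_eq_1')

lemma fps_deriv_inverse_two_minus_exp_power:
  "fps_deriv (inverse (2 - fps_exp \<beta>) ^ m) =
     fps_const (real m * \<beta>) * fps_exp \<beta> * (inverse (2 - fps_exp \<beta>) :: real fps) ^ Suc m"
\<comment> \<open>\<open>fps_deriv_power\<close> produces the truncated exponent
  \<open>m - 1\<close>, hence the split; for \<open>m = Suc k\<close> the exponents \<open>k\<close>
  and 2 add up to \<open>Suc m\<close>.\<close>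
proof (cases m)
  case (Suc k)
  have "fps_deriv (inverse (2 - fps_exp \<beta>)) =
      fps_const \<beta> * fps_exp \<beta> * (inverse (2 - fps_exp \<beta>))\<^sup>2"
    by (simp add: fps_inverse_deriv)
  thus ?thesis
    unfolding Suc fps_deriv_power
    by (simp only: fps_const_mult [symmetric] diff_Suc_1 power_Suc power2_eq_square mult_ac)
qed simp

text \<open>Binomial convolution is multiplication of exponential generating functions. The shift to
  \<open>i + 1\<close> is differentiation, and the powers of \<gamma> come from
  \<open>fps_exp \<gamma>\<close>.\<close>

lemma binomial_sum_H:
  "(\<Sum>i = 0..n. real (n choose i) * H (i + 1) m \<beta> 0 * \<gamma> ^ (n - i)) =
     fact n * fps_nth (fps_deriv (inverse (2 - fps_exp \<beta>) ^ m) * fps_exp \<gamma>) n"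
  unfolding fps_mult_nth sum_distrib_left
proof (rule sum.cong)
  fix i assume "i \<in> {0..n}"
  thus "real (n choose i) * H (i + 1) m \<beta> 0 * \<gamma> ^ (n - i) =
      fact n * (fps_nth (fps_deriv (inverse (2 - fps_exp \<beta>) ^ m)) i * fps_nth (fps_exp \<gamma>) (n - i))"
    by (simp add: H_conv_inverse binomial_fact field_simps)
qed simp

lemma H_recurrence:
  fixes \<beta> :: real
  assumes "\<beta> \<noteq> 0" and "m \<noteq> 0"
  shows "H n (Suc m) \<beta> \<beta> = 1 / 2 * H n m \<beta> \<beta> +
           1 / (2 * \<beta> * real m) *
             (\<Sum>i = 0..n. real (n choose i) * H (i + 1) m \<beta> 0 * \<beta> ^ (n - i))"
proof -
  define E where "E = fps_exp \<beta>"
  define J where "J = inverse (2 - E)"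
  have J: "(2 - E) * J = 1"
    unfolding J_def E_def by (rule inverse_two_minus_exp)
  \<comment> \<open>Inserting the factor \<open>(2 - E) * J = 1\<close> raises the first term to
    \<open>J ^ Suc m\<close>; its part \<open>- E * E * J ^ Suc m\<close> then cancels the second
    term.\<close>
  have "E * J ^ m + E * E * J ^ Suc m = E * J ^ m * ((2 - E) * J) + E * E * J ^ Suc m"
    by (simp only: J mult_1_right)
  also have "\<dots> = fps_const 2 * (E * J ^ Suc m)"
    by (simp add: algebra_simps numeral_fps_const)
  finally have "fps_nth (E * J ^ m) n + fps_nth (E * E * J ^ Suc m) n = 2 * fps_nth (E * J ^ Suc m) n"
    by (metis fps_add_nth fps_mult_left_const_nth)
  moreover have "fps_deriv (J ^ m) * E = fps_const (real m * \<beta>) * (E * E * J ^ Suc m)"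
    unfolding J_def E_def fps_deriv_inverse_two_minus_exp_power by (simp only: mult_ac)
  hence "fps_nth (fps_deriv (J ^ m) * E) n = real m * \<beta> * fps_nth (E * E * J ^ Suc m) n"
    by (simp only: fps_mult_left_const_nth)
  ultimately show ?thesis
    unfolding binomial_sum_H unfolding H_conv_inverse
    \<comment> \<open>\<open>J ^ Suc m\<close> stays folded to match the coefficient identities, and
      reversing \<open>distrib_left\<close> collects the common factor
      \<open>fact n\<close>.\<close>
    using assms by (fold E_def, fold J_def) (simp add: field_simps del: power_Suc flip: distrib_left)
qed

theorem theorem7:
  fixes \<beta> l n :: nat
  assumes "\<beta> \<ge> 1" and "l \<ge> 2"
  shows "H n l (real \<beta>) (real \<beta>) =
           1 / 2 * H n (l - 1) (real \<beta>) (real \<beta>) +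
           1 / (2 * real \<beta> * (real l - 1)) *
             (\<Sum>i = 0..n. real (n choose i) * H (i + 1) (l - 1) (real \<beta>) 0 * real \<beta> ^ (n - i))"
  \<comment> \<open>From \<open>l \<ge> 2\<close>, \<open>l - 1\<close> is nonzero,
    \<open>Suc (l - 1) = l\<close> and \<open>real (l - 1) = real l - 1\<close>.\<close>
  using H_recurrence[of "real \<beta>" "l - 1" n] assms by (simp add: of_nat_diff)

end
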